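(* Let $G$ be a small category and let $A=B\rtimes_\alpha^\sigma G$ be a simple crossed product algebra such that every $\sigma_g$, for $g\in\mathrm{mor}(G)$, is surjective. Then $B$ is $G$-simple.
   Context: Rings are not necessarily associative. Ideals are two-sided. A ring is simple if it has no ideals other than $\{0\}$ and itself. For a small category $G$, $\mathrm{ob}(G)$ and $\mathrm{mor}(G)$ are its objects and morphisms (objects are identified with their identity morphisms), $d(g)$ and $c(g)$ are the domain and codomain of a morphism $g$, and $G^{(2)}$ is the set of pairs $(g,h)$ of morphisms with $d(g)=c(h)$. Crossed product: Let $\mathrm{Ring}$ be the category of unital rings and ring homomorphisms preserving the multiplicative identity. A crossed system is a pair $(\sigma,\alpha)$ where $\sigma:G\to\mathrm{Ring}$ is a functor, with $B_e$ denoting the ring assigned to $e\in\mathrm{ob}(G)$ and $\sigma_g:B_{d(g)}\to B_{c(g)}$ the homomorphism assigned to $g\in\mathrm{mor}(G)$, and $\alpha$ assigns to each $(g,h)\in G^{(2)}$ a unit $\alpha_{g,h}$ of $B_{c(g)}$ which associates and commutes with elements of $B_{c(g)}$, i.e. $\alpha_{g,h}(bc)=(b\alpha_{g,h})c=b(\alpha_{g,h}c)=(bc)\alpha_{g,h}$ for all $b,c\in B_{c(g)}$; moreover $\alpha_{c(g),g}=\alpha_{g,d(g)}=1_{B_{c(g)}}$ for all $g$. Put $B=\bigoplus_{e\in\mathrm{ob}(G)}B_e$. The crossed product algebra $A=B\rtimes_\alpha^\sigma G$ is the set of formal sums $\sum_{g\in\mathrm{mor}(G)}b_gu_g$ with $b_g\in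 B_{c(g)}$, all but finitely many zero, with pointwise addition and multiplication the biadditive extension of $(a_gu_g)(b_hu_h)=a_g\sigma_g(b_h)\alpha_{g,h}u_{gh}$ if $d(g)=c(h)$ and $(a_gu_g)(b_hu_h)=0$ otherwise. It is graded by $A_g=B_{c(g)}u_g$ and locally unital (each $A_e$, $e\in\mathrm{ob}(G)$, is non-zero and unital with identity $1_{B_e}u_e$); $B$ is identified with $\bigoplus_{e\in\mathrm{ob}(G)}A_e$. For an ideal $I$ of $B$ put $I_e=I\cap B_e$. $I$ is $G$-invariant if $\sigma_g(I_{d(g)})\subseteq I_{c(g)}$ for all $g\in\mathrm{mor}(G)$. $B$ is $G$-simple if there is no non-trivial $G$-invariant ideal of $B$ (i.e. none other than $\{0\}$ and $B$). *)

theory Defs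
  imports "HOL-Algebra.AbelCoset"
begin

section \<open>Rings that need not be associative\<close>

text \<open>
  The record type of \<^theory>\<open>HOL-Algebra.Ring\<close> is reused, but its locale \<open>ring\<close> and the locale
  \<open>ideal\<close> built on it assume associativity. The notions \<^const>\<open>additive_subgroup\<close>,
  \<^const>\<open>ring_hom\<close> (which includes preservation of \<open>\<one>\<close>) and \<^const>\<open>Units\<close> do not, and are used
  as they are. A ring is not assumed to be unital; for such a ring the record field \<open>one\<close> carries
  no meaning.
\<close>

locale nonassoc_ring = abelian_group R for R (structure) +
  assumes m_closed: "\<lbrakk>x \<in> carrier R; y \<in> carrier R\<rbrakk> \<Longrightarrow> x \<otimes> y \<in> carrier R"
    and l_distr: "\<lbrakk>x \<in> carrier R; y \<in> carrier R; z \<in> carrier R\<rbrakk>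
      \<Longrightarrow> (x \<oplus> y) \<otimes> z = x \<otimes> z \<oplus> y \<otimes> z"
    and r_distr: "\<lbrakk>x \<in> carrier R; y \<in> carrier R; z \<in> carrier R\<rbrakk>
      \<Longrightarrow> z \<otimes> (x \<oplus> y) = z \<otimes> x \<oplus> z \<otimes> y"

locale nonassoc_unital_ring = nonassoc_ring R for R (structure) +
  assumes one_closed: "\<one> \<in> carrier R"
    and l_one: "x \<in> carrier R \<Longrightarrow> \<one> \<otimes> x = x"
    and r_one: "x \<in> carrier R \<Longrightarrow> x \<otimes> \<one> = x"

definition two_sided_ideal :: "'a set \<Rightarrow> 'a ring \<Rightarrow> bool" where
  "two_sided_ideal I R \<longleftrightarrow> additive_subgroup I R \<and>
     (\<forall>x \<in> I. \<forall>r \<in> carrier R. r \<otimes>\<^bsub>R\<^esub> x \<in> I \<and> x \<otimes>\<^bsub>R\<^esub> r \<in> I)"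

definition simple_ring :: "'a ring \<Rightarrow> bool" where
  "simple_ring R \<longleftrightarrow> (\<forall>I. two_sided_ideal I R \<longrightarrow> I = {\<zero>\<^bsub>R\<^esub>} \<or> I = carrier R)"

text \<open>
  Elements are extensional functions, equal to \<open>undefined\<close> off the index set. For an infinite
  index set the family of identities in the field \<open>one\<close> is in general not an element.
\<close>

definition direct_sum_ring :: "'i set \<Rightarrow> ('i \<Rightarrow> 'a ring) \<Rightarrow> ('i \<Rightarrow> 'a) ring" where
  "direct_sum_ring J R =
    \<lparr>carrier = {x \<in> (\<Pi>\<^sub>E i \<in> J. carrier (R i)). finite {i \<in> J. x i \<noteq> \<zero>\<^bsub>R i\<^esub>}},
     mult = (\<lambda>x y. \<lambda>i \<in> J. x i \<otimes>\<^bsub>R i\<^esub> y i),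
     one = (\<lambda>i \<in> J. \<one>\<^bsub>R i\<^esub>),
     zero = (\<lambda>i \<in> J. \<zero>\<^bsub>R i\<^esub>),
     add = (\<lambda>x y. \<lambda>i \<in> J. x i \<oplus>\<^bsub>R i\<^esub> y i)\<rparr>"

definition direct_sum_inj :: "'i set \<Rightarrow> ('i \<Rightarrow> 'a ring) \<Rightarrow> 'i \<Rightarrow> 'a \<Rightarrow> 'i \<Rightarrow> 'a" where
  "direct_sum_inj J R i b = (\<lambda>j \<in> J. if j = i then b else \<zero>\<^bsub>R j\<^esub>)"

section \<open>Small categories\<close>

text \<open>
  Objects are identified with their identity morphisms, so \<open>ob G \<subseteq> mor G\<close>. The composite
  \<open>comp_of G g h\<close>, written \<open>gh\<close> on paper, is meaningful when \<open>dom_of G g = cod_of G h\<close>.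
\<close>

record 'm category =
  ob :: "'m set"
  mor :: "'m set"
  dom_of :: "'m \<Rightarrow> 'm"
  cod_of :: "'m \<Rightarrow> 'm"
  comp_of :: "'m \<Rightarrow> 'm \<Rightarrow> 'm"

definition composable :: "'m category \<Rightarrow> ('m \<times> 'm) set" where
  "composable G = {(g, h). g \<in> mor G \<and> h \<in> mor G \<and> dom_of G g = cod_of G h}"

locale small_category =
  fixes G :: "'m category"
  assumes ob_subset: "ob G \<subseteq> mor G"
    and dom_ob: "g \<in> mor G \<Longrightarrow> dom_of G g \<in> ob G"
    and cod_ob: "g \<in> mor G \<Longrightarrow> cod_of G g \<in> ob G"
    and dom_id: "e \<in> ob G \<Longrightarrow> dom_of G e = e"
    and cod_id: "e \<in> ob G \<Longrightarrow> cod_of G e = e"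
    and comp_closed: "(g, h) \<in> composable G \<Longrightarrow> comp_of G g h \<in> mor G"
    and dom_comp: "(g, h) \<in> composable G \<Longrightarrow> dom_of G (comp_of G g h) = dom_of G h"
    and cod_comp: "(g, h) \<in> composable G \<Longrightarrow> cod_of G (comp_of G g h) = cod_of G g"
    and comp_id_left: "g \<in> mor G \<Longrightarrow> comp_of G (cod_of G g) g = g"
    and comp_id_right: "g \<in> mor G \<Longrightarrow> comp_of G g (dom_of G g) = g"
    and comp_assoc: "\<lbrakk>(g, h) \<in> composable G; (h, k) \<in> composable G\<rbrakk>
      \<Longrightarrow> comp_of G (comp_of G g h) k = comp_of G g (comp_of G h k)"

section \<open>Crossed systems and crossed products\<close>

text \<open>
  Only the values of \<open>B\<close> on objects, of \<open>\<sigma> g\<close> on \<open>carrier (B (dom_of G g))\<close> and of \<open>\<alpha>\<close> on composable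
  pairs matter. The assumption \<open>B_nonzero\<close> says that the homogeneous components of the crossed
  product at the objects are non-zero, which is part of the crossed product being locally unital.
  No cocycle condition on \<open>\<alpha>\<close> is imposed.
\<close>

locale crossed_system = small_category G
  for G :: "'m category" +
  fixes B :: "'m \<Rightarrow> 'a ring"
    and \<sigma> :: "'m \<Rightarrow> 'a \<Rightarrow> 'a"
    and \<alpha> :: "'m \<Rightarrow> 'm \<Rightarrow> 'a"
  assumes B_ring: "e \<in> ob G \<Longrightarrow> nonassoc_unital_ring (B e)"
    and B_nonzero: "e \<in> ob G \<Longrightarrow> carrier (B e) \<noteq> {\<zero>\<^bsub>B e\<^esub>}"
    and \<sigma>_hom: "g \<in> mor G \<Longrightarrow> \<sigma> g \<in> ring_hom (B (dom_of G g)) (B (cod_of G g))"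
    and \<sigma>_id: "\<lbrakk>e \<in> ob G; b \<in> carrier (B e)\<rbrakk> \<Longrightarrow> \<sigma> e b = b"
    and \<sigma>_comp: "\<lbrakk>(g, h) \<in> composable G; b \<in> carrier (B (dom_of G h))\<rbrakk>
      \<Longrightarrow> \<sigma> (comp_of G g h) b = \<sigma> g (\<sigma> h b)"
    and \<alpha>_unit: "(g, h) \<in> composable G \<Longrightarrow> \<alpha> g h \<in> Units (B (cod_of G g))"
    and \<alpha>_central:
      "\<lbrakk>(g, h) \<in> composable G; b \<in> carrier (B (cod_of G g)); c \<in> carrier (B (cod_of G g))\<rbrakk>
       \<Longrightarrow> \<alpha> g h \<otimes>\<^bsub>B (cod_of G g)\<^esub> (b \<otimes>\<^bsub>B (cod_of G g)\<^esub> c)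
             = (b \<otimes>\<^bsub>B (cod_of G g)\<^esub> \<alpha> g h) \<otimes>\<^bsub>B (cod_of G g)\<^esub> c
         \<and> (b \<otimes>\<^bsub>B (cod_of G g)\<^esub> \<alpha> g h) \<otimes>\<^bsub>B (cod_of G g)\<^esub> c
             = b \<otimes>\<^bsub>B (cod_of G g)\<^esub> (\<alpha> g h \<otimes>\<^bsub>B (cod_of G g)\<^esub> c)
         \<and> b \<otimes>\<^bsub>B (cod_of G g)\<^esub> (\<alpha> g h \<otimes>\<^bsub>B (cod_of G g)\<^esub> c)
             = (b \<otimes>\<^bsub>B (cod_of G g)\<^esub> c) \<otimes>\<^bsub>B (cod_of G g)\<^esub> \<alpha> g h"
    and \<alpha>_id_left: "g \<in> mor G \<Longrightarrow> \<alpha> (cod_of G g) g = \<one>\<^bsub>B (cod_of G g)\<^esub>"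
    and \<alpha>_id_right: "g \<in> mor G \<Longrightarrow> \<alpha> g (dom_of G g) = \<one>\<^bsub>B (cod_of G g)\<^esub>"

text \<open>
  A formal sum \<open>\<Sum> b\<^sub>g u\<^sub>g\<close> is the function sending \<open>g\<close> to \<open>b\<^sub>g\<close>. The coefficient of \<open>u\<^sub>k\<close> in a product
  collects the terms \<open>(x\<^sub>g u\<^sub>g)(y\<^sub>h u\<^sub>h)\<close> with \<open>gh = k\<close>; it is restricted to the supports of \<open>x\<close> and
  \<open>y\<close> because \<^const>\<open>finsum\<close> over an infinite index set is zero by convention. The field \<open>one\<close> is
  the formal sum of all \<open>1 u\<^sub>e\<close>, which is an element only if there are finitely many objects.
\<close>

definition crossed_product ::
  "'m category \<Rightarrow> ('m \<Rightarrow> 'a ring) \<Rightarrow> ('m \<Rightarrow> 'a \<Rightarrow> 'a) \<Rightarrow> ('m \<Rightarrow> 'm \<Rightarrow> 'a) \<Rightarrow> ('m \<Rightarrow> 'a) ring" where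
  "crossed_product G B \<sigma> \<alpha> =
    \<lparr>carrier = {x \<in> (\<Pi>\<^sub>E g \<in> mor G. carrier (B (cod_of G g))).
                 finite {g \<in> mor G. x g \<noteq> \<zero>\<^bsub>B (cod_of G g)\<^esub>}},
     mult = (\<lambda>x y. \<lambda>k \<in> mor G.
       finsum (B (cod_of G k))
         (\<lambda>(g, h). (x g \<otimes>\<^bsub>B (cod_of G g)\<^esub> \<sigma> g (y h)) \<otimes>\<^bsub>B (cod_of G g)\<^esub> \<alpha> g h)
         {(g, h) \<in> composable G. comp_of G g h = k \<and>
            x g \<noteq> \<zero>\<^bsub>B (cod_of G g)\<^esub> \<and> y h \<noteq> \<zero>\<^bsub>B (cod_of G h)\<^esub>}),
     one = (\<lambda>g \<in> mor G. if g \<in> ob G then \<one>\<^bsub>B (cod_of G g)\<^esub> else \<zero>\<^bsub>B (cod_of G g)\<^esub>),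
     zero = (\<lambda>g \<in> mor G. \<zero>\<^bsub>B (cod_of G g)\<^esub>),
     add = (\<lambda>x y. \<lambda>g \<in> mor G. x g \<oplus>\<^bsub>B (cod_of G g)\<^esub> y g)\<rparr>"

section \<open>Invariant ideals\<close>

abbreviation base_ring :: "'m category \<Rightarrow> ('m \<Rightarrow> 'a ring) \<Rightarrow> ('m \<Rightarrow> 'a) ring" where
  "base_ring G B \<equiv> direct_sum_ring (ob G) B"

text \<open>The intersection of \<open>I\<close> with the summand \<open>B e\<close>, as a subset of \<open>B e\<close>.\<close>

definition ideal_component ::
  "'m category \<Rightarrow> ('m \<Rightarrow> 'a ring) \<Rightarrow> ('m \<Rightarrow> 'a) set \<Rightarrow> 'm \<Rightarrow> 'a set" where
  "ideal_component G B I e = {b \<in> carrier (B e). direct_sum_inj (ob G) B e b \<in> I}"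

definition G_invariant ::
  "'m category \<Rightarrow> ('m \<Rightarrow> 'a ring) \<Rightarrow> ('m \<Rightarrow> 'a \<Rightarrow> 'a) \<Rightarrow> ('m \<Rightarrow> 'a) set \<Rightarrow> bool" where
  "G_invariant G B \<sigma> I \<longleftrightarrow>
     (\<forall>g \<in> mor G. \<sigma> g ` ideal_component G B I (dom_of G g) \<subseteq> ideal_component G B I (cod_of G g))"

definition G_simple ::
  "'m category \<Rightarrow> ('m \<Rightarrow> 'a ring) \<Rightarrow> ('m \<Rightarrow> 'a \<Rightarrow> 'a) \<Rightarrow> bool" where
  "G_simple G B \<sigma> \<longleftrightarrow>
     (\<forall>I. two_sided_ideal I (base_ring G B) \<and> G_invariant G B \<sigma> I \<longrightarrow>
        I = {\<zero>\<^bsub>base_ring G B\<^esub>} \<or> I = carrier (base_ring G B))"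

end

theory Submission imports Defs
begin

text \<open>
  For a \<open>G\<close>-invariant ideal \<open>I\<close> of \<open>B\<close>, the formal sums \<open>\<Sum> b\<^sub>g u\<^sub>g\<close> with every \<open>b\<^sub>g\<close> in \<open>I\<^bsub>c(g)\<^esub>\<close> form an
  ideal of the crossed product: closure under multiplication from the right uses that \<open>I\<^bsub>c(g)\<^esub>\<close> is
  an ideal, and from the left that \<open>\<sigma>\<^sub>g\<close> maps \<open>I\<^bsub>d(g)\<^esub>\<close> into \<open>I\<^bsub>c(g)\<^esub>\<close>. By simplicity it is zero or
  everything, so either all \<open>I\<^sub>e\<close> vanish or all \<open>I\<^sub>e = B\<^sub>e\<close>. Since the summands are unital, \<open>I\<close> is the
  direct sum of the \<open>I\<^sub>e\<close>.
\<close>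

section \<open>Products with zero and finite sums without associativity\<close>

context nonassoc_ring
begin

lemma l_null: "x \<in> carrier R \<Longrightarrow> \<zero> \<otimes> x = \<zero>"
  using l_distr[of \<zero> \<zero> x] m_closed[of \<zero> x] add.l_cancel_one by fastforce

lemma r_null: "x \<in> carrier R \<Longrightarrow> x \<otimes> \<zero> = \<zero>"
  using r_distr[of \<zero> \<zero> x] m_closed[of x \<zero>] add.l_cancel_one by fastforce

end

text \<open>Coefficients of a product in the crossed product are values of \<open>finsum\<close>;
  this places them in an ideal once all terms lie there. For infinite \<open>A\<close> the value is
  zero by convention, which \<open>H\<close> contains as well.\<close>

lemma (in abelian_group) additive_subgroup_finsum_closed:
  assumes "additive_subgroup H G" "\<And>i. i \<in> A \<Longrightarrow> f i \<in> H"
  shows "finsum G f A \<in> H"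
proof -
  interpret H: additive_subgroup H G by fact
  show ?thesis
    using assms(2)
  proof (induction A rule: infinite_finite_induct)
    case (insert a A)
    then have "finsum G f (insert a A) = f a \<oplus> finsum G f A"
      using H.a_subset by (intro finsum_insert) auto
    with insert show ?case by (simp add: H.a_closed)
  qed (simp_all add: H.zero_closed)
qed

lemma two_sided_idealD:
  assumes "two_sided_ideal I R"
  shows "additive_subgroup I R"
    and "x \<in> I \<Longrightarrow> r \<in> carrier R \<Longrightarrow> r \<otimes>\<^bsub>R\<^esub> x \<in> I"
    and "x \<in> I \<Longrightarrow> r \<in> carrier R \<Longrightarrow> x \<otimes>\<^bsub>R\<^esub> r \<in> I"
  using assms by (auto simp: two_sided_ideal_def)

section \<open>Ideals of direct sums\<close>

lemma direct_sum_ring_abelian_group: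
  assumes "\<And>i. i \<in> J \<Longrightarrow> abelian_group (R i)"
  shows "abelian_group (direct_sum_ring J R)"
proof (rule abelian_groupI)
  note ag = abelian_group.axioms(1)[OF assms]
  \<comment> \<open>The support of a sum lies in the union of the two supports.\<close>
  have fin: "finite {i \<in> J. x i \<oplus>\<^bsub>R i\<^esub> y i \<noteq> \<zero>\<^bsub>R i\<^esub>}"
    if "finite {i \<in> J. x i \<noteq> \<zero>\<^bsub>R i\<^esub>}" "finite {i \<in> J. y i \<noteq> \<zero>\<^bsub>R i\<^esub>}" for x y
    by (rule finite_subset[OF _ finite_UnI[OF that]])
      (auto simp: abelian_monoid.l_zero[OF ag] abelian_monoid.zero_closed[OF ag])
  fix x y assume x: "x \<in> carrier (direct_sum_ring J R)" and y: "y \<in> carrier (direct_sum_ring J R)"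
  then show "x \<oplus>\<^bsub>direct_sum_ring J R\<^esub> y \<in> carrier (direct_sum_ring J R)"
    using fin[of x y] by (auto simp: direct_sum_ring_def PiE_iff abelian_monoid.a_closed[OF ag]
        cong: conj_cong)
  show "x \<oplus>\<^bsub>direct_sum_ring J R\<^esub> y = y \<oplus>\<^bsub>direct_sum_ring J R\<^esub> x"
    using x y by (auto simp: direct_sum_ring_def PiE_iff abelian_monoid.a_comm[OF ag]
        intro!: restrict_ext)
  show "x \<oplus>\<^bsub>direct_sum_ring J R\<^esub> y \<oplus>\<^bsub>direct_sum_ring J R\<^esub> z =
      x \<oplus>\<^bsub>direct_sum_ring J R\<^esub> (y \<oplus>\<^bsub>direct_sum_ring J R\<^esub> z)"
    if "z \<in> carrier (direct_sum_ring J R)" for z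
    using x y that by (auto simp: direct_sum_ring_def PiE_iff abelian_monoid.a_assoc[OF ag]
        intro!: restrict_ext)
  show "\<zero>\<^bsub>direct_sum_ring J R\<^esub> \<oplus>\<^bsub>direct_sum_ring J R\<^esub> x = x"
    using x by (auto simp: direct_sum_ring_def PiE_iff abelian_monoid.l_zero[OF ag]
        intro!: extensionalityI[of _ J])
  show "\<exists>z\<in>carrier (direct_sum_ring J R). z \<oplus>\<^bsub>direct_sum_ring J R\<^esub> x = \<zero>\<^bsub>direct_sum_ring J R\<^esub>"
  proof
    have "finite {i \<in> J. \<ominus>\<^bsub>R i\<^esub> x i \<noteq> \<zero>\<^bsub>R i\<^esub>}"
      by (rule finite_subset[of _ "{i \<in> J. x i \<noteq> \<zero>\<^bsub>R i\<^esub>}"])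
        (use x in \<open>auto simp: direct_sum_ring_def abelian_group.minus_equality[OF assms]
          abelian_monoid.l_zero[OF ag] abelian_monoid.zero_closed[OF ag]\<close>)
    then show "(\<lambda>i\<in>J. \<ominus>\<^bsub>R i\<^esub> x i) \<in> carrier (direct_sum_ring J R)"
      using x by (auto simp: direct_sum_ring_def PiE_iff abelian_group.a_inv_closed[OF assms]
        cong: conj_cong)
    show "(\<lambda>i\<in>J. \<ominus>\<^bsub>R i\<^esub> x i) \<oplus>\<^bsub>direct_sum_ring J R\<^esub> x = \<zero>\<^bsub>direct_sum_ring J R\<^esub>"
      using x by (auto simp: direct_sum_ring_def PiE_iff abelian_group.l_neg[OF assms]
        intro!: restrict_ext)
  qed
next
  note ag = abelian_group.axioms(1)[OF assms]
  show "\<zero>\<^bsub>direct_sum_ring J R\<^esub> \<in> carrier (direct_sum_ring J R)"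
    by (auto simp: direct_sum_ring_def abelian_monoid.zero_closed[OF ag] cong: conj_cong)
qed

text \<open>The inverse in the direct sum is specified only by its defining property, so unfolding
  does not give it entrywise. Evaluating \<open>-x + x = 0\<close> at \<open>i\<close> and using
  uniqueness of inverses in \<open>R i\<close> does.\<close>

lemma direct_sum_ring_minus:
  assumes "\<And>i. i \<in> J \<Longrightarrow> abelian_group (R i)" "x \<in> carrier (direct_sum_ring J R)" "i \<in> J"
  shows "(\<ominus>\<^bsub>direct_sum_ring J R\<^esub> x) i = \<ominus>\<^bsub>R i\<^esub> x i"
proof -
  interpret D: abelian_group "direct_sum_ring J R"
    by (rule direct_sum_ring_abelian_group) (fact assms)
  interpret Ri: abelian_group "R i" using assms by blast
  have cl: "\<ominus>\<^bsub>direct_sum_ring J R\<^esub> x \<in> carrier (direct_sum_ring J R)"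
    using assms(2) by simp
  have "(\<ominus>\<^bsub>direct_sum_ring J R\<^esub> x \<oplus>\<^bsub>direct_sum_ring J R\<^esub> x) i = \<zero>\<^bsub>direct_sum_ring J R\<^esub> i"
    using D.l_neg[OF assms(2)] by simp
  then have "(\<ominus>\<^bsub>direct_sum_ring J R\<^esub> x) i \<oplus>\<^bsub>R i\<^esub> x i = \<zero>\<^bsub>R i\<^esub>"
    using assms(3) by (simp add: direct_sum_ring_def)
  then show ?thesis
    using cl assms(2,3) by (intro Ri.minus_equality[symmetric]) (auto simp: direct_sum_ring_def)
qed

text \<open>Addition, negation and zero are entrywise, so closure can be checked in each summand.
  With morphisms as indices, this is the additive half of the ideal property in the crossed
  product.\<close>

lemma direct_sum_additive_subgroup:
  assumes R: "\<And>i. i \<in> J \<Longrightarrow> abelian_group (R i)"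
    and H: "\<And>i. i \<in> J \<Longrightarrow> additive_subgroup (H i) (R i)"
  shows "additive_subgroup {x \<in> carrier (direct_sum_ring J R). \<forall>i\<in>J. x i \<in> H i}
           (direct_sum_ring J R)"
proof -
  interpret D: abelian_group "direct_sum_ring J R"
    by (rule direct_sum_ring_abelian_group) (fact R)
  let ?S = "{x \<in> carrier (direct_sum_ring J R). \<forall>i\<in>J. x i \<in> H i}"
  note a_inv_H = additive_subgroup.a_inv_closed[OF H]
  have "subgroup ?S (add_monoid (direct_sum_ring J R))"
  proof (rule D.add.subgroupI)
    show "?S \<subseteq> carrier (direct_sum_ring J R)" by auto
    have "\<zero>\<^bsub>direct_sum_ring J R\<^esub> \<in> ?S"
      using D.zero_closed by (simp add: direct_sum_ring_def additive_subgroup.zero_closed[OF H])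
    then show "?S \<noteq> {}" by blast
    fix x y assume x: "x \<in> ?S" and y: "y \<in> ?S"
    show "\<ominus>\<^bsub>direct_sum_ring J R\<^esub> x \<in> ?S"
      using x D.a_inv_closed
      by (auto simp: direct_sum_ring_minus[OF R] a_inv_H)
    show "x \<oplus>\<^bsub>direct_sum_ring J R\<^esub> y \<in> ?S"
      using x y D.a_closed[of x y]
      by (auto simp: direct_sum_ring_def additive_subgroup.a_closed[OF H])
  qed
  then show ?thesis by (rule additive_subgroupI)
qed

lemma direct_sum_inj_closed:
  assumes "\<And>i. i \<in> J \<Longrightarrow> abelian_group (R i)" "i \<in> J" "b \<in> carrier (R i)"
  shows "direct_sum_inj J R i b \<in> carrier (direct_sum_ring J R)"
proof -
  have "finite {j \<in> J. direct_sum_inj J R i b j \<noteq> \<zero>\<^bsub>R j\<^esub>}"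
    by (rule finite_subset[of _ "{i}"]) (auto simp: direct_sum_inj_def)
  then show ?thesis
    using assms abelian_monoid.zero_closed[OF abelian_group.axioms(1)[OF assms(1)]]
    by (auto simp: direct_sum_ring_def direct_sum_inj_def PiE_iff)
qed

lemma direct_sum_inj_add:
  assumes "\<And>i. i \<in> J \<Longrightarrow> abelian_group (R i)"
  shows "direct_sum_inj J R i b \<oplus>\<^bsub>direct_sum_ring J R\<^esub> direct_sum_inj J R i c =
    direct_sum_inj J R i (b \<oplus>\<^bsub>R i\<^esub> c)"
  using abelian_group.axioms(1)[OF assms] abelian_monoid.l_zero abelian_monoid.zero_closed
  by (fastforce simp: direct_sum_ring_def direct_sum_inj_def)

text \<open>Multiplication is entrywise, and away from \<open>i\<close> one factor is zero. Taking
  \<open>b\<close> to be the identity of \<open>R i\<close>, such a product cuts out the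
  \<open>i\<close>-th entry of \<open>x\<close>.\<close>

lemma direct_sum_mult_inj:
  assumes R: "\<And>i. i \<in> J \<Longrightarrow> nonassoc_ring (R i)" and "x \<in> carrier (direct_sum_ring J R)"
  shows "x \<otimes>\<^bsub>direct_sum_ring J R\<^esub> direct_sum_inj J R i b = direct_sum_inj J R i (x i \<otimes>\<^bsub>R i\<^esub> b)"
    and "direct_sum_inj J R i b \<otimes>\<^bsub>direct_sum_ring J R\<^esub> x = direct_sum_inj J R i (b \<otimes>\<^bsub>R i\<^esub> x i)"
  using assms(2)
  by (auto simp: direct_sum_ring_def direct_sum_inj_def PiE_iff
      nonassoc_ring.l_null[OF R] nonassoc_ring.r_null[OF R] intro!: restrict_ext)

lemma direct_sum_inj_same: "i \<in> J \<Longrightarrow> direct_sum_inj J R i b i = b"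
  by (simp add: direct_sum_inj_def)

lemma direct_sum_inj_zero:
  "direct_sum_inj J R i \<zero>\<^bsub>R i\<^esub> = \<zero>\<^bsub>direct_sum_ring J R\<^esub>"
  by (auto simp: direct_sum_inj_def direct_sum_ring_def)

text \<open>The embedding of \<open>R i\<close> is additive and multiplicative, so the ideal
  properties of \<open>I\<close> pull back along it.\<close>

lemma direct_sum_ideal_component:
  assumes R: "\<And>i. i \<in> J \<Longrightarrow> nonassoc_ring (R i)"
    and I: "two_sided_ideal I (direct_sum_ring J R)" and i: "i \<in> J"
  shows "two_sided_ideal {b \<in> carrier (R i). direct_sum_inj J R i b \<in> I} (R i)"
proof -
  note ag = nonassoc_ring.axioms(1)[OF R]
  interpret D: abelian_group "direct_sum_ring J R"
    by (rule direct_sum_ring_abelian_group) (fact ag)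
  interpret Ri: nonassoc_ring "R i" by (rule R[OF i])
  interpret I: additive_subgroup I "direct_sum_ring J R"
    by (rule two_sided_idealD(1)[OF I])
  let ?K = "{b \<in> carrier (R i). direct_sum_inj J R i b \<in> I}"
  note inj_closed = direct_sum_inj_closed[of J R, OF ag i]
  have "subgroup ?K (add_monoid (R i))"
  proof (rule Ri.add.subgroupI)
    show "?K \<subseteq> carrier (R i)" by auto
    have "\<zero>\<^bsub>R i\<^esub> \<in> ?K" by (simp add: direct_sum_inj_zero I.zero_closed)
    then show "?K \<noteq> {}" by blast
    fix b c assume b: "b \<in> ?K" and c: "c \<in> ?K"
    show "b \<oplus>\<^bsub>R i\<^esub> c \<in> ?K"
      using b c I.a_closed direct_sum_inj_add[of J R i b c] ag by fastforce
    have "direct_sum_inj J R i (\<ominus>\<^bsub>R i\<^esub> b) = \<ominus>\<^bsub>direct_sum_ring J R\<^esub> direct_sum_inj J R i b"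
      using b direct_sum_inj_add[of J R i "\<ominus>\<^bsub>R i\<^esub> b" b] ag
      by (intro D.minus_equality[symmetric])
        (auto simp: Ri.l_neg direct_sum_inj_zero inj_closed)
    then show "\<ominus>\<^bsub>R i\<^esub> b \<in> ?K"
      using b I.a_inv_closed by simp
  qed
  then have "additive_subgroup ?K (R i)" by (rule additive_subgroupI)
  moreover have "r \<otimes>\<^bsub>R i\<^esub> b \<in> ?K \<and> b \<otimes>\<^bsub>R i\<^esub> r \<in> ?K" if "b \<in> ?K" "r \<in> carrier (R i)" for b r
    using that two_sided_idealD(2,3)[OF I, of "direct_sum_inj J R i b" "direct_sum_inj J R i r"]
    by (simp add: direct_sum_mult_inj[OF R] inj_closed direct_sum_inj_same i Ri.m_closed)
  ultimately show ?thesis by (simp add: two_sided_ideal_def)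
qed

text \<open>From left to right, multiply \<open>x\<close> by the embedded identity of
  \<open>R i\<close>; this is where the summands have to be unital. Conversely, \<open>x\<close> is
  the finite sum of its embedded entries.\<close>

lemma direct_sum_ideal_iff:
  assumes R: "\<And>i. i \<in> J \<Longrightarrow> nonassoc_unital_ring (R i)"
    and I: "two_sided_ideal I (direct_sum_ring J R)"
    and x: "x \<in> carrier (direct_sum_ring J R)"
  shows "x \<in> I \<longleftrightarrow> (\<forall>i\<in>J. direct_sum_inj J R i (x i) \<in> I)"
proof
  note nr = nonassoc_unital_ring.axioms(1)[OF R]
  note ag = nonassoc_ring.axioms(1)[OF nr]
  interpret I: additive_subgroup I "direct_sum_ring J R"
    by (rule two_sided_idealD(1)[OF I])
  show "\<forall>i\<in>J. direct_sum_inj J R i (x i) \<in> I" if "x \<in> I"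
  proof
    fix i assume i: "i \<in> J"
    have "x \<otimes>\<^bsub>direct_sum_ring J R\<^esub> direct_sum_inj J R i \<one>\<^bsub>R i\<^esub> \<in> I"
      by (rule two_sided_idealD(3)[OF I that])
        (rule direct_sum_inj_closed[of J R, OF ag i nonassoc_unital_ring.one_closed[OF R[OF i]]])
    moreover have "x i \<in> carrier (R i)"
      using x i by (auto simp: direct_sum_ring_def)
    ultimately show "direct_sum_inj J R i (x i) \<in> I"
      using i by (simp add: direct_sum_mult_inj[OF nr x] nonassoc_unital_ring.r_one[OF R])
  qed
  \<comment> \<open>Induction on a finite set \<open>F\<close> that merely contains the support. The
    element varies, since the induction hypothesis is applied to \<open>x\<close> with its entry at
    \<open>j\<close> replaced by zero.\<close>
  have "x \<in> I" if "finite F" "x \<in> carrier (direct_sum_ring J R)"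
    "{i \<in> J. x i \<noteq> \<zero>\<^bsub>R i\<^esub>} \<subseteq> F" "\<forall>i\<in>J. direct_sum_inj J R i (x i) \<in> I" for F x
    using that
  proof (induction F arbitrary: x rule: finite_induct)
    case empty
    then have "x = \<zero>\<^bsub>direct_sum_ring J R\<^esub>"
      by (auto simp: direct_sum_ring_def PiE_iff intro!: extensionalityI[of _ J])
    then show ?case by (simp add: I.zero_closed)
  next
    case (insert j F)
    note zero = abelian_monoid.zero_closed[OF abelian_group.axioms(1)[OF ag]]
    show ?case
    proof (cases "j \<in> J")
      case False
      with insert show ?thesis by (metis (no_types, lifting) mem_Collect_eq subset_insert)
    next
      case j: True
      let ?y = "x(j := \<zero>\<^bsub>R j\<^esub>)"
      have "finite {i \<in> J. ?y i \<noteq> \<zero>\<^bsub>R i\<^esub>}"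
        by (rule finite_subset[OF _ insert.hyps(1)]) (use insert.prems(2) in auto)
      moreover have "?y \<in> (\<Pi>\<^sub>E i \<in> J. carrier (R i))"
        using insert.prems(1) j zero by (auto simp: direct_sum_ring_def PiE_iff extensional_def)
      ultimately have y: "?y \<in> carrier (direct_sum_ring J R)"
        by (simp add: direct_sum_ring_def)
      have "?y \<in> I"
      proof (rule insert.IH[OF y])
        show "{i \<in> J. ?y i \<noteq> \<zero>\<^bsub>R i\<^esub>} \<subseteq> F" using insert.prems(2) by auto
        show "\<forall>i\<in>J. direct_sum_inj J R i (?y i) \<in> I"
          using insert.prems(3) by (auto simp: direct_sum_inj_zero I.zero_closed)
      qed
      \<comment> \<open>Split off the entry at \<open>j\<close>: the first summand is in
        \<open>I\<close> by assumption, the second by the induction hypothesis.\<close>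
      moreover have "x = direct_sum_inj J R j (x j) \<oplus>\<^bsub>direct_sum_ring J R\<^esub> ?y"
        using insert.prems(1) j zero
          abelian_monoid.l_zero[OF abelian_group.axioms(1)[OF ag]]
          abelian_monoid.r_zero[OF abelian_group.axioms(1)[OF ag]]
        by (auto simp: direct_sum_ring_def PiE_iff direct_sum_inj_def
            intro!: extensionalityI[of _ J])
      ultimately show ?thesis
        using insert.prems(3) j I.a_closed by metis
    qed
  qed
  then show "x \<in> I" if "\<forall>i\<in>J. direct_sum_inj J R i (x i) \<in> I"
    using that x by (auto simp: direct_sum_ring_def)
qed

section \<open>The ideal of the crossed product generated by an invariant ideal\<close>

text \<open>Additively, formal sums are just a direct sum indexed by all morphisms, with
  \<open>B (cod_of G g)\<close> as the summand at \<open>g\<close>. Facts about carrier and addition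
  therefore carry over; only the multiplication is special.\<close>

lemma crossed_product_additive:
  "carrier (crossed_product G B \<sigma> \<alpha>) =
     carrier (direct_sum_ring (mor G) (\<lambda>g. B (cod_of G g)))"
  "add_monoid (crossed_product G B \<sigma> \<alpha>) =
     add_monoid (direct_sum_ring (mor G) (\<lambda>g. B (cod_of G g)))"
  by (simp_all add: crossed_product_def direct_sum_ring_def)

context crossed_system
begin

text \<open>Closure under multiplication from either side reduces to the products of coefficients
  before the twist by \<alpha>. Only the components of an invariant ideal of the base ring matter
  here, hence the formulation with a family \<open>K\<close>.\<close>

lemma crossed_product_ideal:
  assumes K: "\<And>e. e \<in> ob G \<Longrightarrow> two_sided_ideal (K e) (B e)"
    and inv: "\<And>g. g \<in> mor G \<Longrightarrow> \<sigma> g ` K (dom_of G g) \<subseteq> K (cod_of G g)"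
  shows "two_sided_ideal
    {x \<in> carrier (crossed_product G B \<sigma> \<alpha>). \<forall>g\<in>mor G. x g \<in> K (cod_of G g)}
    (crossed_product G B \<sigma> \<alpha>)"
    (is "two_sided_ideal ?S ?A")
proof -
  have nr: "nonassoc_ring (B e)" if "e \<in> ob G" for e
    using B_ring[OF that] by (rule nonassoc_unital_ring.axioms)
  have ag: "abelian_group (B e)" if "e \<in> ob G" for e
    using nr[OF that] by (rule nonassoc_ring.axioms)
  have "additive_subgroup ?S (direct_sum_ring (mor G) (\<lambda>g. B (cod_of G g)))"
    unfolding crossed_product_additive(1)
    by (rule direct_sum_additive_subgroup)
      (auto intro: ag cod_ob two_sided_idealD(1)[OF K])
  then have add: "additive_subgroup ?S ?A"
    unfolding additive_subgroup_def crossed_product_additive(2)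
    unfolding crossed_product_additive(1) .
  have KB: "K e \<subseteq> carrier (B e)" if "e \<in> ob G" for e
    using additive_subgroup.a_subset[OF two_sided_idealD(1)[OF K[OF that]]] .
  \<comment> \<open>Serves both orders of multiplication. The conclusion includes that the product
    is again a formal sum, that is, has finite support.\<close>
  have prod: "x \<otimes>\<^bsub>?A\<^esub> y \<in> ?S"
    if x: "x \<in> carrier ?A" and y: "y \<in> carrier ?A"
      and xy: "\<And>g h. (g, h) \<in> composable G \<Longrightarrow>
        x g \<otimes>\<^bsub>B (cod_of G g)\<^esub> \<sigma> g (y h) \<in> K (cod_of G g)" for x y
  proof -
    \<comment> \<open>The value of \<alpha> is the outer right factor, so the ideal absorbs it
      directly.\<close>
    have terms: "(x g \<otimes>\<^bsub>B (cod_of G g)\<^esub> \<sigma> g (y h)) \<otimes>\<^bsub>B (cod_of G g)\<^esub> \<alpha> g h \<in> K (cod_of G g)"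
      if gh: "(g, h) \<in> composable G" for g h
    proof (rule two_sided_idealD(3)[OF K xy[OF gh]])
      show "cod_of G g \<in> ob G" using gh cod_ob by (auto simp: composable_def)
      show "\<alpha> g h \<in> carrier (B (cod_of G g))" using \<alpha>_unit[OF gh] by (simp add: Units_def)
    qed
    \<comment> \<open>Every pair contributing to the coefficient at \<open>k\<close> has
      \<open>cod_of G g = cod_of G k\<close>, so all terms lie in the same ideal
      \<open>K (cod_of G k)\<close>.\<close>
    have coeff: "(x \<otimes>\<^bsub>?A\<^esub> y) k \<in> K (cod_of G k)" if k: "k \<in> mor G" for k
      using k cod_comp
      by (auto simp: crossed_product_def intro!: terms
          abelian_group.additive_subgroup_finsum_closed[OF ag[OF cod_ob[OF k]]
            two_sided_idealD(1)[OF K[OF cod_ob[OF k]]]])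
    \<comment> \<open>A non-zero coefficient at \<open>k\<close> forces a non-empty index set of the
      sum, so \<open>k\<close> is a composite of a morphism in the support of \<open>x\<close> with
      one in the support of \<open>y\<close>. There are finitely many such composites.\<close>
    have supp: "{k \<in> mor G. (x \<otimes>\<^bsub>?A\<^esub> y) k \<noteq> \<zero>\<^bsub>B (cod_of G k)\<^esub>} \<subseteq>
      (\<lambda>(g, h). comp_of G g h) ` ({g \<in> mor G. x g \<noteq> \<zero>\<^bsub>B (cod_of G g)\<^esub>} \<times>
         {h \<in> mor G. y h \<noteq> \<zero>\<^bsub>B (cod_of G h)\<^esub>})" (is "_ \<subseteq> ?T")
    proof
      fix k assume k: "k \<in> {k \<in> mor G. (x \<otimes>\<^bsub>?A\<^esub> y) k \<noteq> \<zero>\<^bsub>B (cod_of G k)\<^esub>}"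
      then interpret Bk: abelian_group "B (cod_of G k)" by (simp add: ag cod_ob)
      let ?P = "{(g, h) \<in> composable G. comp_of G g h = k \<and>
            x g \<noteq> \<zero>\<^bsub>B (cod_of G g)\<^esub> \<and> y h \<noteq> \<zero>\<^bsub>B (cod_of G h)\<^esub>}"
      have "?P \<noteq> {}"
      proof
        assume empty: "?P = {}"
        have "(x \<otimes>\<^bsub>?A\<^esub> y) k = \<zero>\<^bsub>B (cod_of G k)\<^esub>"
          using k by (simp add: crossed_product_def empty)
        with k show False by simp
      qed
      then show "k \<in> ?T" by (force simp: composable_def)
    qed
    have "finite ?T" using x y by (simp add: crossed_product_def)
    with supp have "finite {k \<in> mor G. (x \<otimes>\<^bsub>?A\<^esub> y) k \<noteq> \<zero>\<^bsub>B (cod_of G k)\<^esub>}"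
      by (rule finite_subset)
    moreover have "x \<otimes>\<^bsub>?A\<^esub> y \<in> (\<Pi>\<^sub>E k \<in> mor G. carrier (B (cod_of G k)))"
    proof (rule PiE_I)
      show "(x \<otimes>\<^bsub>?A\<^esub> y) k \<in> carrier (B (cod_of G k))" if "k \<in> mor G" for k
        using coeff[OF that] KB[OF cod_ob[OF that]] by blast
    qed (simp add: crossed_product_def)
    ultimately have "x \<otimes>\<^bsub>?A\<^esub> y \<in> carrier ?A"
      by (simp add: crossed_product_def)
    with coeff show ?thesis by blast
  qed
  have in_B: "x g \<in> carrier (B (cod_of G g))" if "x \<in> carrier ?A" "g \<in> mor G" for x g
    using that by (auto simp: crossed_product_def)
  have "x \<otimes>\<^bsub>?A\<^esub> r \<in> ?S" if x: "x \<in> ?S" and r: "r \<in> carrier ?A" for x r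
  proof (rule prod)
    fix g h assume gh: "(g, h) \<in> composable G"
    then have g: "g \<in> mor G" and "\<sigma> g (r h) \<in> carrier (B (cod_of G g))"
      using ring_hom_closed[OF \<sigma>_hom] in_B[OF r] by (auto simp: composable_def)
    with x show "x g \<otimes>\<^bsub>B (cod_of G g)\<^esub> \<sigma> g (r h) \<in> K (cod_of G g)"
      by (auto intro: two_sided_idealD(3)[OF K[OF cod_ob]])
  qed (use x r in auto)
  moreover have "r \<otimes>\<^bsub>?A\<^esub> x \<in> ?S" if x: "x \<in> ?S" and r: "r \<in> carrier ?A" for x r
  proof (rule prod)
    fix g h assume gh: "(g, h) \<in> composable G"
    then have g: "g \<in> mor G" and "\<sigma> g (x h) \<in> K (cod_of G g)"
      using inv[of g] x by (auto simp: composable_def)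
    then show "r g \<otimes>\<^bsub>B (cod_of G g)\<^esub> \<sigma> g (x h) \<in> K (cod_of G g)"
      using in_B[OF r g] by (intro two_sided_idealD(2)[OF K[OF cod_ob]])
  qed (use x r in auto)
  ultimately show ?thesis
    using add by (simp add: two_sided_ideal_def)
qed

section \<open>Transfer of simplicity from the crossed product to the base ring\<close>

lemma simple_crossed_product_imp_G_simple:
  assumes "simple_ring (crossed_product G B \<sigma> \<alpha>)"
  shows "G_simple G B \<sigma>"
  unfolding G_simple_def
proof (intro allI impI, elim conjE)
  fix I assume I: "two_sided_ideal I (base_ring G B)" and inv: "G_invariant G B \<sigma> I"
  let ?A = "crossed_product G B \<sigma> \<alpha>" and ?K = "ideal_component G B I"
  let ?S = "{x \<in> carrier ?A. \<forall>g\<in>mor G. x g \<in> ?K (cod_of G g)}"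
  have nr: "nonassoc_ring (B e)" if "e \<in> ob G" for e
    using B_ring[OF that] by (rule nonassoc_unital_ring.axioms)
  have ag: "abelian_group (B e)" if "e \<in> ob G" for e
    using nr[OF that] by (rule nonassoc_ring.axioms)
  have K: "two_sided_ideal (?K e) (B e)" if "e \<in> ob G" for e
    unfolding ideal_component_def by (rule direct_sum_ideal_component[OF nr I that])
  interpret I: additive_subgroup I "base_ring G B"
    by (rule two_sided_idealD(1)[OF I])
  have in_B: "x e \<in> carrier (B e)" if "x \<in> carrier (base_ring G B)" "e \<in> ob G" for x e
    using that by (auto simp: direct_sum_ring_def)
  \<comment> \<open>An ideal of the base ring is determined by its components, so both cases below
    need only settle each \<open>?K e\<close>.\<close>
  have I_iff: "x \<in> I \<longleftrightarrow> (\<forall>e\<in>ob G. x e \<in> ?K e)" if "x \<in> carrier (base_ring G B)" for x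
    using direct_sum_ideal_iff[OF B_ring I that] in_B[OF that] by (simp add: ideal_component_def)
  \<comment> \<open>For an object \<open>e\<close>, \<open>?u e b\<close> is the homogeneous element
    \<open>b u_e\<close>. Its coefficient at \<open>e\<close> lies in \<open>B e\<close> because
    \<open>cod_of G e = e\<close>.\<close>
  let ?u = "direct_sum_inj (mor G) (\<lambda>g. B (cod_of G g))"
  have u_closed: "?u e b \<in> carrier ?A" if "e \<in> ob G" "b \<in> carrier (B e)" for e b
    unfolding crossed_product_additive(1)
    by (rule direct_sum_inj_closed) (use that ob_subset cod_ob cod_id ag in auto)
  have u_same: "?u e b e = b" if "e \<in> ob G" for e b
    using that ob_subset by (simp add: direct_sum_inj_same subset_iff)
  have "two_sided_ideal ?S ?A"
    using K inv by (intro crossed_product_ideal) (auto simp: G_invariant_def)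
  then have "?S = {\<zero>\<^bsub>?A\<^esub>} \<or> ?S = carrier ?A"
    using assms by (simp add: simple_ring_def)
  then show "I = {\<zero>\<^bsub>base_ring G B\<^esub>} \<or> I = carrier (base_ring G B)"
  proof
    assume S: "?S = {\<zero>\<^bsub>?A\<^esub>}"
    \<comment> \<open>For \<open>b\<close> in the component at \<open>e\<close>, the element
      \<open>b u_e\<close> lies in \<open>?S\<close>, hence is zero; its coefficient at
      \<open>e\<close> is \<open>b\<close>.\<close>
    have K0: "b = \<zero>\<^bsub>B e\<^esub>" if e: "e \<in> ob G" and b: "b \<in> ?K e" for e b
    proof -
      have "?u e b g \<in> ?K (cod_of G g)" if "g \<in> mor G" for g
        using that b e cod_id[OF e]
          additive_subgroup.zero_closed[OF two_sided_idealD(1)[OF K[OF cod_ob]]]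
        by (auto simp: direct_sum_inj_def)
      moreover have "?u e b \<in> carrier ?A"
        using b e by (intro u_closed) (auto simp: ideal_component_def)
      ultimately have "?u e b = \<zero>\<^bsub>?A\<^esub>" using S by blast
      then have "?u e b e = \<zero>\<^bsub>?A\<^esub> e" by simp
      then show ?thesis
        using e ob_subset cod_id[OF e] by (auto simp: u_same crossed_product_def)
    qed
    have "x = \<zero>\<^bsub>base_ring G B\<^esub>" if "x \<in> I" for x
    proof -
      have x: "x \<in> carrier (base_ring G B)" using that I.a_subset by blast
      then have "x e = \<zero>\<^bsub>B e\<^esub>" if "e \<in> ob G" for e
        using K0 I_iff \<open>x \<in> I\<close> that by blast
      then show ?thesis
        using x by (auto simp: direct_sum_ring_def PiE_iff intro!: extensionalityI[of _ "ob G"])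
    qed
    then show ?thesis using I.zero_closed by blast
  next
    assume S: "?S = carrier ?A"
    \<comment> \<open>Now every \<open>b u_e\<close> lies in \<open>?S\<close>, and its coefficient
      at \<open>e\<close> shows that \<open>b\<close> is in the component. Thus each component is
      all of \<open>B e\<close>.\<close>
    have "b \<in> ?K e" if e: "e \<in> ob G" and b: "b \<in> carrier (B e)" for e b
    proof -
      have "?u e b \<in> ?S" using S u_closed[OF e b] by blast
      then have "?u e b e \<in> ?K (cod_of G e)" using e ob_subset by blast
      then show ?thesis using e by (simp add: u_same cod_id)
    qed
    then show ?thesis using I_iff in_B I.a_subset by blast
  qed
qed

end

theorem proposition3p14:
  fixes G :: "'m category"
    and B :: "'m \<Rightarrow> 'a ring"
    and \<sigma> :: "'m \<Rightarrow> 'a \<Rightarrow> 'a"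
    and \<alpha> :: "'m \<Rightarrow> 'm \<Rightarrow> 'a"
  assumes "crossed_system G B \<sigma> \<alpha>"
    and "simple_ring (crossed_product G B \<sigma> \<alpha>)"
    and "\<And>g. g \<in> mor G \<Longrightarrow> \<sigma> g ` carrier (B (dom_of G g)) = carrier (B (cod_of G g))"
  shows "G_simple G B \<sigma>"
  using assms(1,2) by (rule crossed_system.simple_crossed_product_imp_G_simple)

end
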